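(* Let $\mathcal{E}\subset\mathbb{R}^d$ be open, let $\mathcal{H}\subseteq\mathbb{R}^m$, and let $F_{\theta^*}:\mathcal{E}\to\mathcal{H}$ be a map. Let $\mathrm{Embed}:\mathcal{X}\to\mathcal{E}$ be a function on a set $\mathcal{X}$, let $\mu_x\in\mathcal{X}$ and $\mu_e=\mathrm{Embed}(\mu_x)\in\mathcal{E}$, and let $\epsilon_d>0$, $\gamma_p>0$, $C\ge 0$. Suppose that the closed Euclidean ball $\mathcal{B}(\mu_e,\epsilon_d)$ is contained in $\mathcal{E}$, that $F_{\theta^*}$ is differentiable at every point of this ball, and that $$\|\nabla_e F_{\theta^*}(e)\|_{\mathrm{op}}\le\gamma_p\qquad\text{for all } e\in\mathcal{B}(\mu_e,\epsilon_d).$$ Let $S:\mathcal{H}\to\mathbb{R}$ be $C$-Lipschitz continuous with respect to the Euclidean norm, and put $S_0=S(F_{\theta^*}(\mu_e))$. Then for every $x\in\mathcal{X}$ with $\|\mathrm{Embed}(x)-\mu_e\|_2\le\epsilon_d$, setting $e=\mathrm{Embed}(x)$ and $h=F_{\theta^*}(e)$, one has $$S(h)\ \ge\ S_0-C\cdot\epsilon_d\cdot\gamma_p .$$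
   Context: Interpretation: $\mathcal{X}$ is an input token space, $\mathrm{Embed}$ the embedding function, $F_{\theta^*}$ the single-step forward map of a model with frozen parameters $\theta^*$ (a fixed map), $\mathcal{H}$ the hidden state space, and $S$ an observable safety margin. $\nabla_e F_{\theta^*}(e)$ denotes the Jacobian (Fréchet derivative) of $F_{\theta^*}$ at $e$; $\|\cdot\|_{\mathrm{op}}$ is the operator norm (largest singular value) with respect to Euclidean norms; $\mathcal{B}(\mu_e,\epsilon_d)$ is the closed Euclidean ball of radius $\epsilon_d$ centred at $\mu_e$. *)

theory Defs
  imports "HOL-Analysis.Analysis"
begin

end

theory Submission
  imports Defs
begin

text \<open>The margin can drop only as far as two successive Lipschitz estimates allow. A closed
  ball is convex, so the segment from \<open>\<mu>\<^sub>e\<close> to \<open>Embed x\<close> stays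
  inside it, and the mean value inequality (\<open>differentiable_bound\<close>) turns the bound
  \<open>\<gamma>\<^sub>p\<close> on the Jacobian into a Lipschitz bound for \<open>F\<close> along
  that segment: the hidden state moves by at most
  \<open>\<gamma>\<^sub>p * \<epsilon>\<^sub>d\<close>. The Lipschitz property of \<open>S\<close>
  multiplies this displacement by at most \<open>C\<close>.\<close>

theorem mainTheorem1:
  fixes \<E> :: "(real ^ 'd) set"
    and \<H> :: "(real ^ 'm) set"
    and F :: "real ^ 'd \<Rightarrow> real ^ 'm"
    and \<X> :: "'x set"
    and Embed :: "'x \<Rightarrow> real ^ 'd"
    and \<mu>\<^sub>x :: 'x
    and \<mu>\<^sub>e :: "real ^ 'd"
    and \<epsilon>\<^sub>d \<gamma>\<^sub>p C :: real
    and S :: "real ^ 'm \<Rightarrow> real"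
    and S\<^sub>0 :: real
  assumes "open \<E>"
    and "F \<in> \<E> \<rightarrow> \<H>"
    and "Embed \<in> \<X> \<rightarrow> \<E>"
    and "\<mu>\<^sub>x \<in> \<X>"
    and "\<mu>\<^sub>e = Embed \<mu>\<^sub>x"
    and "\<epsilon>\<^sub>d > 0"
    and "\<gamma>\<^sub>p > 0"
    and "C \<ge> 0"
    and "cball \<mu>\<^sub>e \<epsilon>\<^sub>d \<subseteq> \<E>"
    and "\<forall>e\<in>cball \<mu>\<^sub>e \<epsilon>\<^sub>d. F differentiable (at e)"
    and "\<forall>e\<in>cball \<mu>\<^sub>e \<epsilon>\<^sub>d. onorm (frechet_derivative F (at e)) \<le> \<gamma>\<^sub>p"
    and "C-lipschitz_on \<H> S"
    and "S\<^sub>0 = S (F \<mu>\<^sub>e)"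
  shows "\<forall>x\<in>\<X>. norm (Embed x - \<mu>\<^sub>e) \<le> \<epsilon>\<^sub>d \<longrightarrow>
    (let e = Embed x; h = F e in S h \<ge> S\<^sub>0 - C * \<epsilon>\<^sub>d * \<gamma>\<^sub>p)"
proof (intro ballI impI)
  fix x
  assume x: "x \<in> \<X>" and "norm (Embed x - \<mu>\<^sub>e) \<le> \<epsilon>\<^sub>d"
  then have dist_e: "dist (Embed x) \<mu>\<^sub>e \<le> \<epsilon>\<^sub>d"
    by (simp add: dist_norm)
  have "norm (F (Embed x) - F \<mu>\<^sub>e) \<le> \<gamma>\<^sub>p * norm (Embed x - \<mu>\<^sub>e)"
  proof (rule differentiable_bound [OF convex_cball])
    \<comment> \<open>\<open>frechet_derivative\<close> is a choice operator; differentiability at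
      \<open>e\<close> guarantees that the chosen map really is the derivative. It is then
      restricted to the ball, as the mean value inequality asks for derivatives within the convex
      set.\<close>
    show "(F has_derivative frechet_derivative F (at e)) (at e within cball \<mu>\<^sub>e \<epsilon>\<^sub>d)"
      if "e \<in> cball \<mu>\<^sub>e \<epsilon>\<^sub>d" for e
      using assms(10) that by (blast intro: has_derivative_at_withinI
          dest: frechet_derivative_works [THEN iffD1])
    show "onorm (frechet_derivative F (at e)) \<le> \<gamma>\<^sub>p" if "e \<in> cball \<mu>\<^sub>e \<epsilon>\<^sub>d" for e
      using assms(11) that by blast
    show "Embed x \<in> cball \<mu>\<^sub>e \<epsilon>\<^sub>d" "\<mu>\<^sub>e \<in> cball \<mu>\<^sub>e \<epsilon>\<^sub>d"
      using dist_e \<open>\<epsilon>\<^sub>d > 0\<close> by (simp_all add: dist_commute)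
  qed
  also have "\<dots> \<le> \<gamma>\<^sub>p * \<epsilon>\<^sub>d"
    using dist_e \<open>\<gamma>\<^sub>p > 0\<close> by (simp add: dist_norm)
  finally have dist_F: "dist (F (Embed x)) (F \<mu>\<^sub>e) \<le> \<gamma>\<^sub>p * \<epsilon>\<^sub>d"
    by (simp add: dist_norm)
  \<comment> \<open>\<open>S\<close> is Lipschitz only on \<H>, so both hidden states must be
    located there; each is the image under \<open>F\<close> of an embedded token.\<close>
  have "F (Embed x) \<in> \<H>" "F \<mu>\<^sub>e \<in> \<H>"
    using assms(2-5) x by blast+
  then have "dist (S (F (Embed x))) (S (F \<mu>\<^sub>e)) \<le> C * dist (F (Embed x)) (F \<mu>\<^sub>e)"
    using \<open>C-lipschitz_on \<H> S\<close> by (rule lipschitz_onD [rotated])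
  also have "\<dots> \<le> C * (\<gamma>\<^sub>p * \<epsilon>\<^sub>d)"
    using dist_F \<open>C \<ge> 0\<close> by (rule mult_left_mono)
  \<comment> \<open>The estimate is two-sided; its lower half is the claim.\<close>
  finally have "\<bar>S (F (Embed x)) - S\<^sub>0\<bar> \<le> C * \<epsilon>\<^sub>d * \<gamma>\<^sub>p"
    by (simp add: \<open>S\<^sub>0 = S (F \<mu>\<^sub>e)\<close> dist_real_def mult_ac)
  then show "let e = Embed x; h = F e in S h \<ge> S\<^sub>0 - C * \<epsilon>\<^sub>d * \<gamma>\<^sub>p"
    by (simp add: Let_def abs_le_iff)
qed

end
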